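(* Let $0<\delta<1$ and $0<\rho<\rho_{\mathrm{MSE}}(\delta)$, and define $$M^\flat(\delta,\rho)=\inf_{\tau>0}\ \sup_{\nu\in\mathcal F_{\delta\rho}}\mathrm{fMSE}(\tau;\delta,\sigma=1,\nu).$$ Then $$M^\flat(\delta,\rho)=\frac{M^{\pm}(\delta\rho)}{1-M^{\pm}(\delta\rho)/\delta}.$$ Moreover the threshold rule $\tau^*(\delta,\rho)=\tau^{\pm}(\delta\rho)$ minimaxes the formal MSE: $$\sup_{\nu\in\mathcal F_{\delta\rho}}\mathrm{fMSE}(\tau^*;\delta,1,\nu)=\inf_{\tau>0}\sup_{\nu\in\mathcal F_{\delta\rho}}\mathrm{fMSE}(\tau;\delta,1,\nu)=M^\flat(\delta,\rho).$$
   Context: Soft threshold: $\eta(x;\theta)=x-\theta$ if $x>\theta$, $0$ if $|x|\le\theta$, $x+\theta$ if $x<-\theta$. For $\varepsilon\in[0,1]$, $\mathcal F_\varepsilon$ is the set of probability measures $\nu$ on $\mathbb R$ with $\nu(\{0\})\ge1-\varepsilon$. Scalar risk: $\mathrm{mse}(s^2;\nu,\tau)=\mathbb E\{[\eta(X+sZ;\tau s)-X]^2\}$ with $X\sim\nu$, $Z\sim N(0,1)$ independent. Minimax threshold MSE: $M^{\pm}(\varepsilon)=\inf_{\tau>0}\sup_{\nu\in\mathcal F_\varepsilon}\mathrm{mse}(1;\nu,\tau)$; $\tau^{\pm}(\varepsilon)$ is the threshold attaining the infimum. The function $M^\pm$ is increasing and concave with $M^\pm(0)=0$, $M^\pm(1)=1$.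 Phase boundary: $\rho_{\mathrm{MSE}}(\delta)$ is the value of $\rho$ solving $M^{\pm}(\rho\delta)=\delta$. State evolution: $\mathrm{npi}(m;\sigma,\delta)=\sigma^2+m/\delta$; $\Psi(m)=\Psi(m,\delta,\sigma,\tau,\nu)=\mathrm{mse}(\mathrm{npi}(m;\sigma,\delta);\nu,\tau)$ for $m\ge0$; $\mathrm{HFP}(\Psi)=\sup\{m\ge0:\Psi(m)\ge m\}$ (possibly $+\infty$). The equilibrium formal MSE of the tunable approximate message passing algorithm AMPT$(\tau)$ is $\mathrm{fMSE}(\tau;\delta,\sigma,\nu)=\mathrm{HFP}(\Psi(\cdot,\delta,\sigma,\tau,\nu))$. *)

theory Defs
  imports "HOL-Probability.Probability"
begin

definition soft_threshold :: "real \<Rightarrow> real \<Rightarrow> real" where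
  "soft_threshold x \<theta> =
     (if \<bar>x\<bar> \<le> \<theta> then 0 else if x > \<theta> then x - \<theta> else x + \<theta>)"

definition sparse_class :: "real \<Rightarrow> real measure set" where
  "sparse_class \<epsilon> = {\<nu>. real_distribution \<nu> \<and> measure \<nu> {0} \<ge> 1 - \<epsilon>}"

(* The first argument v is the noise variance, v = s^2. Independence of X and Z is the product
   measure. For v >= 0 and \<tau> >= 0 the integrand is at most (sqrt v * (|Z| + \<tau>))^2, so it is
   integrable even when X has no moments. *)
definition mse :: "real \<Rightarrow> real measure \<Rightarrow> real \<Rightarrow> real" where
  "mse v \<nu> \<tau> =
     (LINT (x, z)|(\<nu> \<Otimes>\<^sub>M density lborel std_normal_density).
        (soft_threshold (x + sqrt v * z) (\<tau> * sqrt v) - x)\<^sup>2)"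

(* By the bound above, the real-valued Sup is that of a set bounded above, for every \<tau> > 0. *)
definition worst_mse :: "real \<Rightarrow> real \<Rightarrow> real" where
  "worst_mse \<epsilon> \<tau> = (SUP \<nu>\<in>sparse_class \<epsilon>. mse 1 \<nu> \<tau>)"

definition minimax_mse :: "real \<Rightarrow> real" where
  "minimax_mse \<epsilon> = (INF \<tau>\<in>{0<..}. worst_mse \<epsilon> \<tau>)"

definition minimax_threshold :: "real \<Rightarrow> real" where
  "minimax_threshold \<epsilon> = (THE \<tau>. 0 < \<tau> \<and> worst_mse \<epsilon> \<tau> = minimax_mse \<epsilon>)"

(* The sparsity \<rho> * \<delta> ranges over [0, 1], the domain of minimax_mse. *)
definition rho_MSE :: "real \<Rightarrow> real" where
  "rho_MSE \<delta> = (THE \<rho>. \<rho> * \<delta> \<in> {0..1} \<and> minimax_mse (\<rho> * \<delta>) = \<delta>)"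

definition npi :: "real \<Rightarrow> real \<Rightarrow> real \<Rightarrow> real" where
  "npi m \<sigma> \<delta> = \<sigma>\<^sup>2 + m / \<delta>"

definition mse_map :: "real \<Rightarrow> real \<Rightarrow> real \<Rightarrow> real \<Rightarrow> real measure \<Rightarrow> real" where
  "mse_map m \<delta> \<sigma> \<tau> \<nu> = mse (npi m \<sigma> \<delta>) \<nu> \<tau>"

definition HFP :: "(real \<Rightarrow> real) \<Rightarrow> ereal" where
  "HFP \<Psi> = (SUP m\<in>{m. 0 \<le> m \<and> \<Psi> m \<ge> m}. ereal m)"

definition fMSE :: "real \<Rightarrow> real \<Rightarrow> real \<Rightarrow> real measure \<Rightarrow> ereal" where
  "fMSE \<tau> \<delta> \<sigma> \<nu> = HFP (\<lambda>m. mse_map m \<delta> \<sigma> \<tau> \<nu>)"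

definition minimax_fMSE :: "real \<Rightarrow> real \<Rightarrow> ereal" where
  "minimax_fMSE \<delta> \<rho> = (INF \<tau>\<in>{0<..}. SUP \<nu>\<in>sparse_class (\<delta> * \<rho>). fMSE \<tau> \<delta> 1 \<nu>)"

definition threshold_rule :: "real \<Rightarrow> real \<Rightarrow> real" where
  "threshold_rule \<delta> \<rho> = minimax_threshold (\<delta> * \<rho>)"

end

(* With clip(y) the truncation of y to [-t, t], the risk at x is E (Z - clip(x + Z))^2. It is at most
   1 + t^2 and tends to 1 + t^2 as x tends to infinity, so the worst case over the sparse class is
   (1 - \<epsilon>) r(t) + \<epsilon> (1 + t^2), where r(t) is the risk at 0. This is strictly convex in t, which
   gives a unique minimax threshold, and affine in \<epsilon>, so the minimax risk M is concave in \<epsilon>. Concavity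
   together with M 1 = 1 gives uniqueness of the phase boundary and M (\<delta> \<rho>) < \<delta> below it.

   The sparse class is invariant under scaling, so the worst risk at noise variance v is v times the one
   at variance 1. A point m with m <= mse_map m therefore satisfies m <= (1 + m / \<delta>) W, where W is the
   worst risk, that is m <= W / (1 - W / \<delta>); rescaled near-worst distributions come arbitrarily close to
   equality. *)

theory Submission
  imports Defs
begin

subsection \<open>Soft thresholding of a normal observation\<close>

definition clip :: "real \<Rightarrow> real \<Rightarrow> real" where
  "clip t y = max (- t) (min t y)"

lemma clip_measurable [measurable]: "clip t \<in> borel_measurable borel"
  unfolding clip_def by measurable

lemma abs_clip_le: "0 \<le> t \<Longrightarrow> \<bar>clip t y\<bar> \<le> t"
  by (auto simp: clip_def)

text \<open>The estimation error becomes \<open>z - clip t (x + z)\<close>, where the signal enters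
  only through a bounded term. Every risk below is therefore finite, whatever the signal.\<close>

lemma soft_threshold_eq_clip: "0 \<le> t \<Longrightarrow> soft_threshold y t = y - clip t y"
  by (auto simp: soft_threshold_def clip_def)

lemma soft_threshold_mult:
  assumes "0 < s"
  shows "soft_threshold (s * y) (t * s) = s * soft_threshold y t"
proof -
  have "\<bar>s * y\<bar> \<le> t * s \<longleftrightarrow> \<bar>y\<bar> \<le> t" "t * s < s * y \<longleftrightarrow> t < y"
    using assms by (auto simp: abs_mult mult.commute)
  then show ?thesis
    by (auto simp: soft_threshold_def algebra_simps)
qed

lemma soft_threshold_measurable [measurable]:
  assumes [measurable]: "f \<in> borel_measurable M"
  shows "(\<lambda>x. soft_threshold (f x) t) \<in> borel_measurable M"
  unfolding soft_threshold_def by measurable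

section \<open>Moments of the standard normal law\<close>

abbreviation std_normal :: "real measure" where
  "std_normal \<equiv> density lborel std_normal_density"

interpretation std_normal: prob_space std_normal
  by (rule prob_space_normal_density) simp

lemma integrable_std_normal_power [simp]: "integrable std_normal (\<lambda>z. z ^ k)"
  using integrable_std_normal_moment[of k] by (subst integrable_density) auto

lemma integrable_std_normal_id [simp]: "integrable std_normal (\<lambda>z. z)"
  using integrable_std_normal_power[of 1] by simp

lemma expectation_std_normal [simp]: "(LINT z|std_normal. z) = 0"
  using integral_std_normal_moment_odd[of 0] by (subst integral_density) auto

lemma expectation_std_normal_sq [simp]: "(LINT z|std_normal. z\<^sup>2) = 1"
  using integral_std_normal_moment_even[of 1] by (subst integral_density) auto

lemma expectation_std_normal_pow4 [simp]: "(LINT z|std_normal. z ^ 4) = 3"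
  using integral_std_normal_moment_even[of 2]
  by (subst integral_density) (auto simp: fact_numeral)

section \<open>Risk at a fixed signal value, at unit noise\<close>

definition risk :: "real \<Rightarrow> real \<Rightarrow> real" where
  "risk t x = (LINT z|std_normal. (z - clip t (x + z))\<^sup>2)"

text \<open>Parallelogram identity. The bound is free of \<open>y\<close>, so it gives integrability
  and also the dominating function in \<open>risk_tendsto\<close>.\<close>

lemma sq_diff_clip_le: "0 \<le> t \<Longrightarrow> (z - clip t y)\<^sup>2 \<le> 2 * z\<^sup>2 + 2 * t\<^sup>2"
proof -
  assume "0 \<le> t"
  then have "(clip t y)\<^sup>2 \<le> t\<^sup>2"
    using abs_clip_le by (metis abs_of_nonneg abs_le_square_iff)
  moreover have "(z - clip t y)\<^sup>2 + (z + clip t y)\<^sup>2 = 2 * z\<^sup>2 + 2 * (clip t y)\<^sup>2"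
    by (simp add: power2_eq_square algebra_simps)
  moreover have "0 \<le> (z + clip t y)\<^sup>2"
    by simp
  ultimately show ?thesis
    by linarith
qed

lemma integrable_risk:
  assumes "0 \<le> t"
  shows "integrable std_normal (\<lambda>z. (z - clip t (x + z))\<^sup>2)"
  by (rule Bochner_Integration.integrable_bound[where f = "\<lambda>z. 2 * z\<^sup>2 + 2 * t\<^sup>2"])
    (use assms sq_diff_clip_le in \<open>auto simp: abs_of_nonneg\<close>)

lemma risk_nonneg: "0 \<le> risk t x"
  unfolding risk_def by simp

lemma risk_measurable [measurable]: "risk t \<in> borel_measurable borel"
  unfolding risk_def by measurable

(* Monotonicity of the clip makes it positively correlated with the noise. *)
lemma risk_le:
  assumes "0 \<le> t"
  shows "risk t x \<le> 1 + t\<^sup>2"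
proof -
  \<comment> \<open>Replacing the clip in the cross term by the constant \<open>clip t x\<close> can
    only enlarge the integrand; the term left is linear in \<open>z\<close> and has mean 0.\<close>
  have "risk t x \<le> (LINT z|std_normal. z\<^sup>2 - 2 * clip t x * z + t\<^sup>2)"
    unfolding risk_def
  proof (rule integral_mono[OF integrable_risk[OF assms]])
    fix z :: real
    have "0 \<le> z * (clip t (x + z) - clip t x)"
      by (cases "0 \<le> z") (auto simp: clip_def intro!: mult_nonneg_nonneg mult_nonpos_nonpos)
    moreover have "(clip t (x + z))\<^sup>2 \<le> t\<^sup>2"
      using assms abs_clip_le by (metis abs_of_nonneg abs_le_square_iff)
    ultimately show "(z - clip t (x + z))\<^sup>2 \<le> z\<^sup>2 - 2 * clip t x * z + t\<^sup>2"
      by (simp add: power2_eq_square algebra_simps)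
  qed simp
  also have "\<dots> = 1 + t\<^sup>2"
    by (simp add: std_normal.prob_space[simplified])
  finally show ?thesis .
qed

text \<open>For fixed \<open>z\<close> the clip saturates at \<open>t\<close> once
  \<open>n \<ge> t - z\<close>, so dominated convergence leads to the second moment of
  \<open>z - t\<close>.\<close>

lemma risk_tendsto:
  assumes "0 \<le> t"
  shows "(\<lambda>n. risk t (real n)) \<longlonglongrightarrow> 1 + t\<^sup>2"
proof -
  have "(\<lambda>n. risk t (real n)) \<longlonglongrightarrow> (LINT z|std_normal. (z - t)\<^sup>2)"
    unfolding risk_def
  proof (rule integral_dominated_convergence[where w = "\<lambda>z. 2 * z\<^sup>2 + 2 * t\<^sup>2"])
    show "AE z in std_normal. (\<lambda>n. (z - clip t (real n + z))\<^sup>2) \<longlonglongrightarrow> (z - t)\<^sup>2"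
    proof (rule AE_I2)
      fix z :: real
      have "\<forall>\<^sub>F n in sequentially. t - z \<le> real n"
        by real_asymp
      then have "\<forall>\<^sub>F n in sequentially. (z - t)\<^sup>2 = (z - clip t (real n + z))\<^sup>2"
        by eventually_elim (use assms in \<open>auto simp: clip_def\<close>)
      then show "(\<lambda>n. (z - clip t (real n + z))\<^sup>2) \<longlonglongrightarrow> (z - t)\<^sup>2"
        by (rule Lim_transform_eventually[OF tendsto_const])
    qed
  qed (use assms sq_diff_clip_le in auto)
  also have "(\<lambda>z::real. (z - t)\<^sup>2) = (\<lambda>z. z\<^sup>2 - 2 * t * z + t\<^sup>2)"
    by (auto simp: power2_eq_square algebra_simps)
  also have "(LINT z|std_normal. z\<^sup>2 - 2 * t * z + t\<^sup>2) = 1 + t\<^sup>2"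
    by (simp add: std_normal.prob_space[simplified])
  finally show ?thesis .
qed

section \<open>Risk at zero signal\<close>

definition null_risk :: "real \<Rightarrow> real" where
  "null_risk t = (LINT z|std_normal. (max 0 (\<bar>z\<bar> - t))\<^sup>2)"

text \<open>Both integrands are the squared soft threshold of \<open>z\<close>. The form with
  \<open>max\<close> displays convexity in \<open>t\<close>, on the whole real line.\<close>

lemma risk_0: "0 \<le> t \<Longrightarrow> risk t 0 = null_risk t"
  unfolding risk_def null_risk_def clip_def
  by (intro Bochner_Integration.integral_cong refl, subst power2_eq_iff)
    (auto simp: max_def min_def abs_if)

lemma null_risk_nonneg: "0 \<le> null_risk t"
  unfolding null_risk_def by simp

lemma integrable_null_risk: "integrable std_normal (\<lambda>z. (max 0 (\<bar>z\<bar> - t))\<^sup>2)"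
proof (rule Bochner_Integration.integrable_bound[where f = "\<lambda>z. 2 * z\<^sup>2 + 2 * t\<^sup>2"])
  show "AE z in std_normal. norm ((max 0 (\<bar>z\<bar> - t))\<^sup>2) \<le> norm (2 * z\<^sup>2 + 2 * t\<^sup>2)"
  proof (rule AE_I2)
    fix z :: real
    have "(max 0 (\<bar>z\<bar> - t))\<^sup>2 \<le> (\<bar>z\<bar> - t)\<^sup>2"
      by (auto simp: max_def)
    also have "\<dots> \<le> (\<bar>z\<bar> - t)\<^sup>2 + (\<bar>z\<bar> + t)\<^sup>2"
      by simp
    also have "\<dots> = 2 * z\<^sup>2 + 2 * t\<^sup>2"
      by (simp add: power2_eq_square algebra_simps)
    finally show "norm ((max 0 (\<bar>z\<bar> - t))\<^sup>2) \<le> norm (2 * z\<^sup>2 + 2 * t\<^sup>2)"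
      by simp
  qed
qed auto

(* The clip of z by t satisfies z * clip t z >= t * (z^2 - z^4 / 4), a lower bound whose expectation is
   given by the normal moments and is positive. So null_risk has negative slope at 0. *)
lemma null_risk_le:
  assumes "0 \<le> t" "t \<le> 1"
  shows "null_risk t \<le> 1 - t / 2 + t\<^sup>2"
proof -
  have "null_risk t \<le> (LINT z|std_normal. z\<^sup>2 - 2 * t * (z\<^sup>2 - z ^ 4 / 4) + t\<^sup>2)"
    unfolding null_risk_def
  proof (rule integral_mono[OF integrable_null_risk])
    fix z :: real
    define a where "a = \<bar>z\<bar>"
    have a: "0 \<le> a" "z\<^sup>2 = a\<^sup>2" "z ^ 4 = a ^ 4"
      by (auto simp: a_def)
    show "(max 0 (\<bar>z\<bar> - t))\<^sup>2 \<le> z\<^sup>2 - 2 * t * (z\<^sup>2 - z ^ 4 / 4) + t\<^sup>2"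
    proof (cases "a \<le> t")
      case True
      \<comment> \<open>The left side of the goal is 0 here. Since \<open>t \<le> 1\<close> and
        \<open>a \<le> t\<close>, the right side is at least t^2 - a^2, which is
        nonnegative.\<close>
      have "2 * t * a\<^sup>2 \<le> 2 * a\<^sup>2 * 1"
        using assms mult_right_mono[of t 1 "a\<^sup>2"] by simp
      moreover have "a\<^sup>2 \<le> t\<^sup>2"
        using True a by simp
      moreover have "0 \<le> 2 * t * (a ^ 4 / 4)"
        using assms by simp
      ultimately show ?thesis
        using True unfolding a by (simp add: a_def[symmetric] algebra_simps)
    next
      case False
      have "a\<^sup>2 - a ^ 4 / 4 \<le> a"
      proof -
        have "0 \<le> a ^ 3 / 4 - a + 1"
        proof -
          \<comment> \<open>This puts a^3 above its tangent at 1, which suffices up to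
            \<open>a = 2\<close>; beyond that a^3 / 4 already exceeds \<open>a\<close>.\<close>
          have "0 \<le> (a - 1)\<^sup>2 * (a + 2)"
            using a by simp
          then have *: "3 * a - 2 \<le> a ^ 3"
            by (simp add: power2_eq_square power3_eq_cube algebra_simps)
          show ?thesis
          proof (cases "a \<le> 2")
            case True
            then show ?thesis using * by simp
          next
            case False
            then have "2\<^sup>2 * a \<le> a\<^sup>2 * a"
              by (intro mult_right_mono power_mono) auto
            then show ?thesis by (simp add: power2_eq_square power3_eq_cube)
          qed
        qed
        then have "0 \<le> a * (a ^ 3 / 4 - a + 1)"
          using a by simp
        then show ?thesis
          by (simp add: power2_eq_square power3_eq_cube power4_eq_xxxx algebra_simps)
      qed
      then have "2 * t * (a\<^sup>2 - a ^ 4 / 4) \<le> 2 * t * a"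
        using assms by (intro mult_left_mono) auto
      then show ?thesis
        using False unfolding a by (simp add: a_def[symmetric] power2_diff algebra_simps)
    qed
  qed simp
  \<comment> \<open>The second and fourth moments are 1 and 3, so the middle term is -2 t (1 -
    3/4).\<close>
  also have "\<dots> = 1 - t / 2 + t\<^sup>2"
    by (simp add: std_normal.prob_space[simplified])
  finally show ?thesis .
qed

lemma null_risk_antimono: "antimono null_risk"
  unfolding null_risk_def antimono_def
  by (intro allI impI integral_mono integrable_null_risk power_mono) auto

lemma null_risk_0: "null_risk 0 = 1"
  unfolding null_risk_def by simp

lemma null_risk_le_1: "0 \<le> t \<Longrightarrow> null_risk t \<le> 1"
  using antimonoD[OF null_risk_antimono, of 0 t] null_risk_0 by simp

text \<open>Where \<open>\<bar>z\<bar> > t\<close>, both \<open>\<bar>z\<bar> - t\<close> and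
  \<open>t\<close> are at most \<open>\<bar>z\<bar>\<close>, so their product is at most z^2.
  Squaring brings in the fourth moment 3.\<close>

lemma null_risk_le_inverse:
  assumes "0 < t"
  shows "null_risk t \<le> 3 / t\<^sup>2"
proof -
  have "null_risk t \<le> (LINT z|std_normal. z ^ 4 / t\<^sup>2)"
    unfolding null_risk_def
  proof (rule integral_mono[OF integrable_null_risk])
    fix z :: real
    have "max 0 (\<bar>z\<bar> - t) * t \<le> z\<^sup>2"
    proof (cases "\<bar>z\<bar> \<le> t")
      case False
      then have "(\<bar>z\<bar> - t) * t \<le> \<bar>z\<bar> * \<bar>z\<bar>"
        using assms by (intro mult_mono) auto
      then show ?thesis
        using False by (simp add: power2_eq_square)
    qed auto
    then have "(max 0 (\<bar>z\<bar> - t) * t)\<^sup>2 \<le> (z\<^sup>2)\<^sup>2"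
      using assms by (intro power_mono) auto
    then show "(max 0 (\<bar>z\<bar> - t))\<^sup>2 \<le> z ^ 4 / t\<^sup>2"
      using assms by (simp add: field_simps power_mult_distrib)
  qed simp
  then show ?thesis
    by simp
qed

text \<open>For each \<open>z\<close>, \<open>max 0 (\<bar>z\<bar> - t)\<close> is convex and
  nonnegative in \<open>t\<close>, and squaring is increasing and convex on nonnegative reals.
  Convexity on the open set \<open>UNIV\<close> later yields continuity.\<close>

lemma convex_on_null_risk: "convex_on UNIV null_risk"
proof (rule convex_onI)
  fix s x y :: real
  assume s: "0 < s" "s < 1"
  have "null_risk ((1 - s) * x + s * y) \<le>
    (LINT z|std_normal. (1 - s) * (max 0 (\<bar>z\<bar> - x))\<^sup>2 + s * (max 0 (\<bar>z\<bar> - y))\<^sup>2)"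
    unfolding null_risk_def
  proof (rule integral_mono[OF integrable_null_risk])
    fix z :: real
    have "max 0 (\<bar>z\<bar> - ((1 - s) * x + s * y)) \<le> (1 - s) * max 0 (\<bar>z\<bar> - x) + s * max 0 (\<bar>z\<bar> - y)"
    proof -
      have "(1 - s) * (\<bar>z\<bar> - x) \<le> (1 - s) * max 0 (\<bar>z\<bar> - x)" "s * (\<bar>z\<bar> - y) \<le> s * max 0 (\<bar>z\<bar> - y)"
        using s by (auto intro!: mult_left_mono)
      then have "\<bar>z\<bar> - ((1 - s) * x + s * y) \<le> (1 - s) * max 0 (\<bar>z\<bar> - x) + s * max 0 (\<bar>z\<bar> - y)"
        by (simp add: algebra_simps)
      moreover have "0 \<le> (1 - s) * max 0 (\<bar>z\<bar> - x) + s * max 0 (\<bar>z\<bar> - y)"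
        using s by simp
      ultimately show ?thesis
        by simp
    qed
    then have "(max 0 (\<bar>z\<bar> - ((1 - s) * x + s * y)))\<^sup>2 \<le> ((1 - s) * max 0 (\<bar>z\<bar> - x) + s * max 0 (\<bar>z\<bar> - y))\<^sup>2"
      by (intro power_mono) auto
    also have "\<dots> \<le> (1 - s) * (max 0 (\<bar>z\<bar> - x))\<^sup>2 + s * (max 0 (\<bar>z\<bar> - y))\<^sup>2"
      using convex_onD[OF convex_power2, of s "max 0 (\<bar>z\<bar> - x)" "max 0 (\<bar>z\<bar> - y)"] s by simp
    finally show "(max 0 (\<bar>z\<bar> - ((1 - s) * x + s * y)))\<^sup>2 \<le> (1 - s) * (max 0 (\<bar>z\<bar> - x))\<^sup>2 + s * (max 0 (\<bar>z\<bar> - y))\<^sup>2" .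
  qed (intro Bochner_Integration.integrable_add integrable_mult_right integrable_null_risk)
  also have "\<dots> = (1 - s) * null_risk x + s * null_risk y"
    unfolding null_risk_def
    by (subst Bochner_Integration.integral_add) (auto intro!: integrable_mult_right integrable_null_risk)
  finally show "null_risk ((1 - s) *\<^sub>R x + s *\<^sub>R y) \<le> (1 - s) * null_risk x + s * null_risk y"
    by simp
qed simp

subsection \<open>Worst-case risk over the sparse class\<close>

text \<open>Fubini applies to every signal law because \<open>risk t\<close> is bounded.\<close>

lemma mse_1_eq:
  assumes "real_distribution \<nu>" "0 \<le> t"
  shows "mse 1 \<nu> t = (LINT x|\<nu>. risk t x)"
proof -
  interpret \<nu>: real_distribution \<nu> by fact
  interpret pair_prob_space \<nu> std_normal ..
  let ?f = "\<lambda>(x, z). (z - clip t (x + z))\<^sup>2"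
  have meas [measurable]: "?f \<in> borel_measurable (\<nu> \<Otimes>\<^sub>M std_normal)"
    by measurable
  have "mse 1 \<nu> t = integral\<^sup>L (\<nu> \<Otimes>\<^sub>M std_normal) ?f"
    unfolding mse_def using assms(2)
    by (intro Bochner_Integration.integral_cong) (auto simp: soft_threshold_eq_clip algebra_simps)
  also have "integrable (\<nu> \<Otimes>\<^sub>M std_normal) ?f"
  proof (rule Fubini_integrable[OF meas])
    have "integrable \<nu> (risk t)"
      by (rule \<nu>.integrable_const_bound[where B = "1 + t\<^sup>2"])
        (use assms(2) risk_le risk_nonneg in auto)
    then show "integrable \<nu> (\<lambda>x. LINT z|std_normal. norm (?f (x, z)))"
      by (simp add: risk_def[abs_def])
  qed (use integrable_risk[OF assms(2)] in auto)
  then have "integral\<^sup>L (\<nu> \<Otimes>\<^sub>M std_normal) ?f = (LINT x|\<nu>. risk t x)"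
    by (subst integral_fst'[symmetric]) (auto simp: risk_def[abs_def])
  finally show ?thesis .
qed

section \<open>Joint scaling of signal and noise\<close>

lemma scale_sparse_class:
  assumes "\<nu> \<in> sparse_class \<epsilon>" "s \<noteq> 0"
  shows "distr \<nu> borel ((*) s) \<in> sparse_class \<epsilon>"
proof -
  interpret \<nu>: real_distribution \<nu>
    using assms by (simp add: sparse_class_def)
  have "(*) s -` {0} \<inter> space \<nu> = {0}"
    using assms by auto
  then have "measure (distr \<nu> borel ((*) s)) {0} = measure \<nu> {0}"
    by (subst measure_distr) auto
  then show ?thesis
    using assms by (auto simp: sparse_class_def intro!: \<nu>.real_distribution_distr)
qed

text \<open>The threshold is proportional to the noise level, so soft thresholding is homogeneous
  and scaling signal and noise together multiplies the squared error by \<open>v\<close>.\<close>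

lemma mse_scale:
  assumes "real_distribution \<nu>" "0 < v"
  shows "mse v (distr \<nu> borel ((*) (sqrt v))) t = v * mse 1 \<nu> t"
proof -
  interpret \<nu>: real_distribution \<nu> by fact
  interpret pair_prob_space \<nu> std_normal ..
  define s where "s = sqrt v"
  have s: "0 < s" "v = s\<^sup>2"
    using assms(2) by (auto simp: s_def)
  \<comment> \<open>The noise factor is written as an image under the identity so that
    \<open>pair_measure_distr\<close> applies to both factors.\<close>
  have "distr \<nu> borel ((*) s) \<Otimes>\<^sub>M std_normal = distr \<nu> borel ((*) s) \<Otimes>\<^sub>M distr std_normal borel (\<lambda>z. z)"
    by (simp add: distr_id2)
  also have "\<dots> = distr (\<nu> \<Otimes>\<^sub>M std_normal) (borel \<Otimes>\<^sub>M borel) (\<lambda>(x, z). (s * x, z))"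
  proof (rule pair_measure_distr)
    show "sigma_finite_measure (distr std_normal borel (\<lambda>z. z))"
      by (simp add: distr_id2 std_normal.sigma_finite_measure_axioms)
  qed auto
  finally have "mse v (distr \<nu> borel ((*) s)) t =
      (LINT (x, z)|(\<nu> \<Otimes>\<^sub>M std_normal). (soft_threshold (s * x + s * z) (t * s) - s * x)\<^sup>2)"
    unfolding mse_def s_def[symmetric]
    by (simp only:) (subst integral_distr, auto simp: case_prod_unfold)
  also have "\<dots> = (LINT p|(\<nu> \<Otimes>\<^sub>M std_normal). v * (case p of (x, z) \<Rightarrow> (soft_threshold (x + z) t - x)\<^sup>2))"
  proof (intro Bochner_Integration.integral_cong refl, clarify)
    fix x z
    have "soft_threshold (s * x + s * z) (t * s) = s * soft_threshold (x + z) t"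
      using soft_threshold_mult[OF s(1), of "x + z" t] by (simp add: algebra_simps)
    then show "(soft_threshold (s * x + s * z) (t * s) - s * x)\<^sup>2 = v * (soft_threshold (x + z) t - x)\<^sup>2"
      unfolding s(2) by (simp add: power2_eq_square algebra_simps)
  qed
  also have "\<dots> = v * mse 1 \<nu> t"
    by (simp add: mse_def)
  finally show ?thesis
    by (simp add: s_def)
qed

section \<open>Closed form of the worst-case risk\<close>

definition two_point :: "real \<Rightarrow> real \<Rightarrow> real measure" where
  "two_point \<epsilon> x = distr (measure_pmf (bernoulli_pmf \<epsilon>)) borel (\<lambda>b. if b then x else 0)"

lemma real_distribution_two_point: "real_distribution (two_point \<epsilon> x)"
  unfolding two_point_def real_distribution_def real_distribution_axioms_def
  by (auto intro!: measure_pmf.prob_space_distr)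

lemma integral_two_point:
  assumes "0 \<le> \<epsilon>" "\<epsilon> \<le> 1" "f \<in> borel_measurable borel"
  shows "(LINT y|two_point \<epsilon> x. f y) = \<epsilon> * f x + (1 - \<epsilon>) * (f 0 :: real)"
  unfolding two_point_def using assms by (subst integral_distr) auto

lemma two_point_sparse:
  assumes "0 \<le> \<epsilon>" "\<epsilon> \<le> 1"
  shows "two_point \<epsilon> x \<in> sparse_class \<epsilon>"
proof -
  have "measure (two_point \<epsilon> x) {0} = (LINT y|two_point \<epsilon> x. indicator {0} y)"
    by (simp add: two_point_def)
  also have "\<dots> = \<epsilon> * indicator {0} x + (1 - \<epsilon>) * indicator {0} (0::real)"
    by (rule integral_two_point) (use assms in auto)
  finally show ?thesis
    using assms real_distribution_two_point by (auto simp: sparse_class_def)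
qed

definition sparse_risk :: "real \<Rightarrow> real \<Rightarrow> real" where
  "sparse_risk \<epsilon> t = (1 - \<epsilon>) * null_risk t + \<epsilon> * (1 + t\<^sup>2)"

text \<open>The risk is \<open>null_risk t\<close> at 0 and at most 1 + t^2 elsewhere. Since the
  former is the smaller value, the bound is largest when the atom at 0 has the least mass
  allowed.\<close>

lemma mse_1_le:
  assumes "\<nu> \<in> sparse_class \<epsilon>" "0 \<le> t"
  shows "mse 1 \<nu> t \<le> sparse_risk \<epsilon> t"
proof -
  interpret \<nu>: real_distribution \<nu>
    using assms by (simp add: sparse_class_def)
  let ?p = "measure \<nu> {0}"
  let ?g = "\<lambda>x. (null_risk t - (1 + t\<^sup>2)) * indicator {0} x + (1 + t\<^sup>2) :: real"
  have "mse 1 \<nu> t = (LINT x|\<nu>. risk t x)"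
    by (rule mse_1_eq) (use assms in \<open>auto simp: sparse_class_def\<close>)
  also have "\<dots> \<le> (LINT x|\<nu>. ?g x)"
  proof (rule integral_mono)
    show "integrable \<nu> (risk t)"
      by (rule \<nu>.integrable_const_bound[where B = "1 + t\<^sup>2"])
        (use assms(2) risk_le risk_nonneg in auto)
    show "integrable \<nu> ?g"
      by (intro Bochner_Integration.integrable_add integrable_mult_right)
        (auto simp: less_top[symmetric])
    show "risk t x \<le> ?g x" for x
      using risk_le[OF assms(2)] risk_0[OF assms(2)] by (auto simp: indicator_def)
  qed
  also have "\<dots> = (null_risk t - (1 + t\<^sup>2)) * ?p + (1 + t\<^sup>2)"
    using \<nu>.prob_space
    by (subst Bochner_Integration.integral_add) (auto intro!: integrable_mult_right simp: less_top[symmetric])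
  also have "\<dots> \<le> (null_risk t - (1 + t\<^sup>2)) * (1 - \<epsilon>) + (1 + t\<^sup>2)"
  proof -
    have "null_risk t - (1 + t\<^sup>2) \<le> 0"
      using null_risk_le_1[OF assms(2)] zero_le_power2[of t] by linarith
    then show ?thesis
      using assms(1) by (simp add: sparse_class_def mult_left_mono_neg)
  qed
  also have "\<dots> = sparse_risk \<epsilon> t"
    by (simp add: sparse_risk_def algebra_simps)
  finally show ?thesis .
qed

lemma bdd_above_mse_1: "0 \<le> t \<Longrightarrow> bdd_above ((\<lambda>\<nu>. mse 1 \<nu> t) ` sparse_class \<epsilon>)"
  using mse_1_le by (intro bdd_aboveI2)

lemma worst_mse_eq:
  assumes "0 \<le> \<epsilon>" "\<epsilon> \<le> 1" "0 \<le> t"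
  shows "worst_mse \<epsilon> t = sparse_risk \<epsilon> t"
proof (rule antisym)
  show "worst_mse \<epsilon> t \<le> sparse_risk \<epsilon> t"
    unfolding worst_mse_def using two_point_sparse[OF assms(1,2)] mse_1_le assms(3)
    by (intro cSUP_least) auto
  \<comment> \<open>The bound is approached by two-point laws with mass \<epsilon> at
    \<open>n\<close>, as \<open>n\<close> tends to infinity.\<close>
  have "(\<lambda>n. \<epsilon> * risk t (real n) + (1 - \<epsilon>) * null_risk t) \<longlonglongrightarrow> sparse_risk \<epsilon> t"
    unfolding sparse_risk_def
    by (auto intro!: tendsto_eq_intros risk_tendsto[OF assms(3)])
  then show "sparse_risk \<epsilon> t \<le> worst_mse \<epsilon> t"
  proof (rule LIMSEQ_le_const2, intro exI allI impI)
    fix n :: nat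
    have "\<epsilon> * risk t (real n) + (1 - \<epsilon>) * null_risk t = mse 1 (two_point \<epsilon> (real n)) t"
      using assms real_distribution_two_point
      by (simp add: mse_1_eq integral_two_point risk_0)
    also have "\<dots> \<le> worst_mse \<epsilon> t"
      unfolding worst_mse_def
      by (rule cSUP_upper[OF two_point_sparse bdd_above_mse_1]) (use assms in auto)
    finally show "\<epsilon> * risk t (real n) + (1 - \<epsilon>) * null_risk t \<le> worst_mse \<epsilon> t" .
  qed
qed

subsection \<open>Minimax risk and phase boundary\<close>

lemma sparse_risk_nonneg: "0 \<le> \<epsilon> \<Longrightarrow> \<epsilon> \<le> 1 \<Longrightarrow> 0 \<le> sparse_risk \<epsilon> t"
  unfolding sparse_risk_def using null_risk_nonneg by simp

lemma minimax_mse_eq: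
  assumes "0 \<le> \<epsilon>" "\<epsilon> \<le> 1"
  shows "minimax_mse \<epsilon> = (INF t\<in>{0<..}. sparse_risk \<epsilon> t)"
  unfolding minimax_mse_def using assms by (intro INF_cong) (auto simp: worst_mse_eq)

lemma minimax_mse_le:
  assumes "0 \<le> \<epsilon>" "\<epsilon> \<le> 1" "0 < t"
  shows "minimax_mse \<epsilon> \<le> sparse_risk \<epsilon> t"
  unfolding minimax_mse_eq[OF assms(1,2)]
proof (rule cINF_lower)
  show "bdd_below (sparse_risk \<epsilon> ` {0<..})"
    using sparse_risk_nonneg[OF assms(1,2)] by (intro bdd_belowI2)
qed (use assms in simp)

lemma minimax_mse_greatest:
  assumes "0 \<le> \<epsilon>" "\<epsilon> \<le> 1" "\<And>t. 0 < t \<Longrightarrow> c \<le> sparse_risk \<epsilon> t"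
  shows "c \<le> minimax_mse \<epsilon>"
  unfolding minimax_mse_eq[OF assms(1,2)] by (rule cINF_greatest) (use assms in auto)

section \<open>Range, concavity, monotonicity and continuity of the minimax risk\<close>

lemma minimax_mse_nonneg: "0 \<le> \<epsilon> \<Longrightarrow> \<epsilon> \<le> 1 \<Longrightarrow> 0 \<le> minimax_mse \<epsilon>"
  by (rule minimax_mse_greatest) (auto intro: sparse_risk_nonneg)

text \<open>Threshold 0 would give exactly 1 but lies outside the infimum, hence the limit from the
  right.\<close>

lemma minimax_mse_le_1:
  assumes "0 \<le> \<epsilon>" "\<epsilon> \<le> 1"
  shows "minimax_mse \<epsilon> \<le> 1"
proof -
  have "((\<lambda>t. 1 + t\<^sup>2) \<longlongrightarrow> 1) (at_right (0::real))"
    by (auto intro!: tendsto_eq_intros)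
  moreover have "\<forall>\<^sub>F t in at_right 0. minimax_mse \<epsilon> \<le> 1 + t\<^sup>2"
    unfolding eventually_at_right_field
  proof (intro exI[of _ 1] conjI allI impI)
    fix t :: real
    assume "0 < t"
    then have "(1 - \<epsilon>) * null_risk t \<le> (1 - \<epsilon>) * 1"
      using assms null_risk_le_1 by (intro mult_left_mono) auto
    moreover have "\<epsilon> * t\<^sup>2 \<le> 1 * t\<^sup>2"
      using assms by (intro mult_right_mono) auto
    ultimately have "sparse_risk \<epsilon> t \<le> 1 + t\<^sup>2"
      by (simp add: sparse_risk_def algebra_simps)
    then show "minimax_mse \<epsilon> \<le> 1 + t\<^sup>2"
      using minimax_mse_le[OF assms \<open>0 < t\<close>] by simp
  qed simp
  ultimately show ?thesis
    by (rule tendsto_lowerbound) simp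
qed

lemma minimax_mse_1: "minimax_mse 1 = 1"
proof (rule antisym)
  show "1 \<le> minimax_mse 1"
    by (rule minimax_mse_greatest) (auto simp: sparse_risk_def)
qed (rule minimax_mse_le_1; simp)

lemma minimax_mse_concave:
  assumes "0 \<le> x" "x \<le> 1" "0 \<le> y" "y \<le> 1" "0 \<le> s" "s \<le> 1"
  shows "(1 - s) * minimax_mse x + s * minimax_mse y \<le> minimax_mse ((1 - s) * x + s * y)"
proof (rule minimax_mse_greatest)
  show "0 \<le> (1 - s) * x + s * y" "(1 - s) * x + s * y \<le> 1"
    using assms convex_bound_le[of x 1 y "1 - s" s] by auto
  fix t :: real
  assume "0 < t"
  then have "(1 - s) * minimax_mse x + s * minimax_mse y \<le> (1 - s) * sparse_risk x t + s * sparse_risk y t"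
    using assms by (intro add_mono mult_left_mono minimax_mse_le) auto
  also have "\<dots> = sparse_risk ((1 - s) * x + s * y) t"
    by (simp add: sparse_risk_def algebra_simps)
  finally show "(1 - s) * minimax_mse x + s * minimax_mse y \<le> sparse_risk ((1 - s) * x + s * y) t" .
qed

text \<open>Concavity between \<open>x\<close> and 1, where the minimax risk is 1; \<open>s\<close>
  is the relative position of \<open>y\<close>. A positive weight on the value 1 is what drives the
  monotonicity results.\<close>

lemma minimax_mse_chord:
  assumes "0 \<le> x" "x < y" "y \<le> 1"
  shows "\<exists>s\<in>{0<..1}. (1 - s) * minimax_mse x + s \<le> minimax_mse y"
proof
  define s where "s = (y - x) / (1 - x)"
  show s: "s \<in> {0<..1}"
    using assms by (auto simp: s_def field_simps)
  have "s * (1 - x) = y - x"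
    using assms by (simp add: s_def)
  then have "(1 - s) * x + s * 1 = y"
    by (simp add: algebra_simps)
  then show "(1 - s) * minimax_mse x + s \<le> minimax_mse y"
    using minimax_mse_concave[of x 1 s] assms s by (simp add: minimax_mse_1)
qed

lemma minimax_mse_less:
  assumes "0 \<le> x" "x < y" "y \<le> 1" "minimax_mse x < 1"
  shows "minimax_mse x < minimax_mse y"
proof -
  obtain s where s: "s \<in> {0<..1}" "(1 - s) * minimax_mse x + s \<le> minimax_mse y"
    using minimax_mse_chord[OF assms(1-3)] by auto
  then have "s * minimax_mse x < s * 1"
    using assms(4) by simp
  then show ?thesis
    using s(2) by (simp add: algebra_simps)
qed

lemma minimax_mse_mono:
  assumes "0 \<le> x" "x \<le> y" "y \<le> 1"
  shows "minimax_mse x \<le> minimax_mse y"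
proof (cases "x = y \<or> minimax_mse x < 1")
  case False
  then have "minimax_mse x = 1"
    using minimax_mse_le_1[of x] assms by simp
  then show ?thesis
    using minimax_mse_chord[of x y] False assms by auto
qed (use minimax_mse_less[of x y] assms in \<open>cases "x = y"; simp\<close>)

text \<open>First \<open>t\<close> is taken large, making the null risk at most d/2, then
  \<open>x\<close> small, making the remaining term at most d/3. This supplies a left endpoint for
  the intermediate value theorem.\<close>

lemma minimax_mse_arbitrarily_small: "\<exists>x. 0 < x \<and> x \<le> 1 \<and> minimax_mse x < d" if "0 < d"
proof -
  define t where "t = max 1 (6 / d)"
  define x where "x = min 1 (d / (3 * (1 + t\<^sup>2)))"
  have pos: "0 < 1 + t\<^sup>2"
    by (simp add: add_pos_nonneg)
  have t: "1 \<le> t" "6 / d \<le> t"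
    by (auto simp: t_def)
  have x: "0 < x" "x \<le> 1" "x \<le> d / (3 * (1 + t\<^sup>2))"
    using that pos by (auto simp: x_def)
  have "t * 1 \<le> t * t"
    using t by (intro mult_left_mono) auto
  then have "6 / d \<le> t\<^sup>2"
    using order_trans[OF t(2)] by (simp add: power2_eq_square)
  then have "3 / t\<^sup>2 \<le> d / 2"
    using that t by (simp add: field_simps)
  then have "null_risk t \<le> d / 2"
    using null_risk_le_inverse[of t] t by simp
  moreover have "(1 - x) * null_risk t \<le> 1 * null_risk t"
    using x null_risk_nonneg by (intro mult_right_mono) auto
  moreover have "x * (1 + t\<^sup>2) \<le> d / 3"
    using x(3) pos by (simp add: field_simps)
  ultimately have "sparse_risk x t < d"
    using that by (simp add: sparse_risk_def)
  then show ?thesis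
    using minimax_mse_le[of x t] x t by (intro exI[of _ x]) auto
qed

(* The chord from 0 gives the Lipschitz bound 1 / a on [a, 1]. *)
lemma continuous_on_minimax_mse:
  assumes "0 < a"
  shows "continuous_on {a..1} minimax_mse"
proof -
  have *: "\<bar>minimax_mse y - minimax_mse x\<bar> \<le> 1 / a * \<bar>y - x\<bar>" if "a \<le> x" "x \<le> y" "y \<le> 1" for x y
  proof -
    have y: "0 < y" using that assms by simp
    have "x / y * minimax_mse y \<le> minimax_mse x"
      using minimax_mse_concave[of 0 y "x / y"] minimax_mse_nonneg[of 0] that assms y
        mult_nonneg_nonneg[of "1 - x / y" "minimax_mse 0"]
      by (simp add: field_simps)
    then have "minimax_mse y - minimax_mse x \<le> (1 - x / y) * minimax_mse y"
      by (simp add: algebra_simps)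
    also have "\<dots> \<le> (1 - x / y) * 1"
      using that y minimax_mse_le_1[of y] by (intro mult_left_mono) auto
    also have "\<dots> = (y - x) / y"
      using y by (simp add: field_simps)
    also have "\<dots> \<le> (y - x) / a"
      using that assms by (intro divide_left_mono) auto
    finally show ?thesis
      using minimax_mse_mono[of x y] that assms by simp
  qed
  have "(1 / a)-lipschitz_on {a..1} minimax_mse"
  proof (rule lipschitz_onI)
    fix x y
    assume "x \<in> {a..1}" "y \<in> {a..1}"
    then show "dist (minimax_mse x) (minimax_mse y) \<le> 1 / a * dist x y"
      using *[of x y] *[of y x] by (cases "x \<le> y") (auto simp: dist_real_def abs_minus_commute)
  qed (use assms in simp)
  then show ?thesis
    by (rule lipschitz_on_continuous_on)
qed

section \<open>The phase boundary is well defined\<close>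

lemma rho_MSE_props:
  assumes "0 < \<delta>" "\<delta> < 1"
  shows "rho_MSE \<delta> * \<delta> \<in> {0..1} \<and> minimax_mse (rho_MSE \<delta> * \<delta>) = \<delta>"
  unfolding rho_MSE_def
proof (rule theI')
  \<comment> \<open>Continuity is available only away from 0, so the intermediate value theorem is
    applied on \<open>{a..1}\<close>.\<close>
  obtain a where a: "0 < a" "a \<le> 1" "minimax_mse a < \<delta>"
    using minimax_mse_arbitrarily_small[OF assms(1)] by auto
  obtain x where x: "a \<le> x" "x \<le> 1" "minimax_mse x = \<delta>"
    using IVT'[of minimax_mse a \<delta> 1] a assms continuous_on_minimax_mse[OF a(1)]
    by (auto simp: minimax_mse_1)
  show "\<exists>!r. r * \<delta> \<in> {0..1} \<and> minimax_mse (r * \<delta>) = \<delta>"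
  proof (rule ex1I[of _ "x / \<delta>"])
    fix r
    assume r: "r * \<delta> \<in> {0..1} \<and> minimax_mse (r * \<delta>) = \<delta>"
    \<comment> \<open>Two distinct solutions would contradict strict increase, which holds at points
      of value \<delta> because \<open>\<delta> < 1\<close>.\<close>
    have "r * \<delta> = x"
      using minimax_mse_less[of x "r * \<delta>"] minimax_mse_less[of "r * \<delta>" x] r x a assms
      by (cases "r * \<delta>" x rule: linorder_cases) auto
    then show "r = x / \<delta>"
      using assms by auto
  qed (use x a assms in auto)
qed

section \<open>Existence and uniqueness of the minimax threshold\<close>

lemma sparse_risk_midpoint_less:
  assumes "0 < \<epsilon>" "\<epsilon> \<le> 1" "x \<noteq> y"
  shows "sparse_risk \<epsilon> ((x + y) / 2) < (sparse_risk \<epsilon> x + sparse_risk \<epsilon> y) / 2"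
proof -
  have "null_risk ((x + y) / 2) \<le> (null_risk x + null_risk y) / 2"
    using convex_onD[OF convex_on_null_risk, of "1/2" x y] by (simp add: add_divide_distrib)
  then have "(1 - \<epsilon>) * null_risk ((x + y) / 2) \<le> (1 - \<epsilon>) * ((null_risk x + null_risk y) / 2)"
    using assms by (intro mult_left_mono) auto
  \<comment> \<open>Strictness comes from the quadratic term alone: this is its midpoint
    defect.\<close>
  moreover have "0 < \<epsilon> * ((x - y) / 2)\<^sup>2"
    using assms by simp
  ultimately show ?thesis
    by (simp add: sparse_risk_def power2_eq_square field_simps)
qed

lemma minimax_threshold_props:
  assumes "0 < \<epsilon>" "\<epsilon> < 1"
  shows "0 < minimax_threshold \<epsilon> \<and> worst_mse \<epsilon> (minimax_threshold \<epsilon>) = minimax_mse \<epsilon>"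
  unfolding minimax_threshold_def
proof (rule theI')
  let ?W = "sparse_risk \<epsilon>"
  have W: "worst_mse \<epsilon> t = ?W t" if "0 < t" for t
    using that assms by (intro worst_mse_eq) auto
  have min: "minimax_mse \<epsilon> \<le> ?W t" if "0 < t" for t
    using that assms by (intro minimax_mse_le) auto
  have "continuous_on UNIV null_risk"
    by (rule convex_on_continuous[OF open_UNIV convex_on_null_risk])
  then have "continuous_on {0..1 / \<epsilon>} ?W"
    unfolding sparse_risk_def by (intro continuous_intros) (auto intro: continuous_on_subset)
  then obtain t where t: "t \<in> {0..1 / \<epsilon>}" "\<And>y. y \<in> {0..1 / \<epsilon>} \<Longrightarrow> ?W t \<le> ?W y"
    using continuous_attains_inf[of "{0..1 / \<epsilon>}" ?W] assms by auto
  \<comment> \<open>This \<open>u\<close> maximises u ((1 - \<epsilon>) / 2 - u), the drop below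
    \<open>?W 0 = 1\<close> guaranteed by \<open>null_risk_le\<close>. It excludes 0 as the
    minimiser.\<close>
  define u where "u = (1 - \<epsilon>) / 4"
  have u: "0 < u" "u \<le> 1"
    using assms by (auto simp: u_def)
  have "u \<le> 1 / \<epsilon>"
    using u assms mult_le_one[of u \<epsilon>] by (simp add: field_simps)
  have "?W u \<le> (1 - \<epsilon>) * (1 - u / 2 + u\<^sup>2) + \<epsilon> * (1 + u\<^sup>2)"
    unfolding sparse_risk_def using null_risk_le[of u] u assms
    by (intro add_mono mult_left_mono) auto
  also have "\<dots> = 1 - u * ((1 - \<epsilon>) / 2 - u)"
    by (simp add: power2_eq_square field_simps)
  also have "\<dots> < 1"
    using u assms by (simp add: u_def)
  finally have "?W u < 1" .
  then have "?W t < 1"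
    using t(2)[of u] u \<open>u \<le> 1 / \<epsilon>\<close> by simp
  then have "t \<noteq> 0"
    by (auto simp: sparse_risk_def null_risk_0)
  then have "0 < t"
    using t by simp
  have "?W t \<le> ?W y" if "0 < y" for y
  proof (cases "y \<le> 1 / \<epsilon>")
    case False
    \<comment> \<open>Beyond 1 / \<epsilon> the term \<epsilon> y^2 alone is at least 1, so the
      minimiser over the compact interval is global.\<close>
    then have "1 \<le> \<epsilon> * y"
      using assms by (simp add: field_simps)
    moreover have "\<epsilon> * y \<le> 1 * y"
      using assms that by (intro mult_right_mono) auto
    ultimately have "1 \<le> \<epsilon> * y" "1 \<le> y"
      by auto
    then have "1 * 1 \<le> (\<epsilon> * y) * y"
      by (intro mult_mono) auto
    moreover have "0 \<le> (1 - \<epsilon>) * null_risk y"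
      using assms null_risk_nonneg by simp
    ultimately have "1 \<le> ?W y"
      using assms by (simp add: sparse_risk_def power2_eq_square algebra_simps)
    then show ?thesis
      using \<open>?W t < 1\<close> by simp
  qed (use t that in simp)
  then have "?W t \<le> minimax_mse \<epsilon>"
    using assms by (intro minimax_mse_greatest) auto
  show "\<exists>!t. 0 < t \<and> worst_mse \<epsilon> t = minimax_mse \<epsilon>"
  proof (rule ex1I[of _ t])
    show "0 < t \<and> worst_mse \<epsilon> t = minimax_mse \<epsilon>"
      using \<open>0 < t\<close> \<open>?W t \<le> minimax_mse \<epsilon>\<close> min[of t] by (simp add: W)
    fix y
    assume y: "0 < y \<and> worst_mse \<epsilon> y = minimax_mse \<epsilon>"
    show "y = t"
    proof (rule ccontr)
      assume "y \<noteq> t"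
      then have "?W ((y + t) / 2) < (?W y + ?W t) / 2"
        using assms by (intro sparse_risk_midpoint_less) auto
      moreover have "?W y = minimax_mse \<epsilon>"
        using y W[of y] by simp
      ultimately show False
        using \<open>?W t \<le> minimax_mse \<epsilon>\<close> min[of "(y + t) / 2"] y \<open>0 < t\<close> by simp
    qed
  qed
qed

subsection \<open>Highest fixed points\<close>

lemma mse_le_worst_mse:
  assumes "\<nu> \<in> sparse_class \<epsilon>" "0 < v" "0 \<le> t"
  shows "mse v \<nu> t \<le> v * worst_mse \<epsilon> t"
proof -
  interpret \<nu>: real_distribution \<nu>
    using assms by (simp add: sparse_class_def)
  \<comment> \<open>Scaling down by \<open>sqrt v\<close> stays in the class and presents \<nu> as a
    scaled copy of \<mu>, the form required by \<open>mse_scale\<close>.\<close>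
  define \<mu> where "\<mu> = distr \<nu> borel ((*) (1 / sqrt v))"
  have \<mu>: "\<mu> \<in> sparse_class \<epsilon>"
    unfolding \<mu>_def using assms by (intro scale_sparse_class) auto
  have "distr \<mu> borel ((*) (sqrt v)) = distr \<nu> borel ((*) (sqrt v) \<circ> (*) (1 / sqrt v))"
    unfolding \<mu>_def by (rule distr_distr) auto
  also have "(*) (sqrt v) \<circ> (*) (1 / sqrt v) = (\<lambda>x. x)"
    using assms by (auto simp: fun_eq_iff)
  also have "distr \<nu> borel (\<lambda>x. x) = \<nu>"
    by (rule distr_id2) simp
  finally have "mse v \<nu> t = v * mse 1 \<mu> t"
    using mse_scale[of \<mu> v t] \<mu> assms by (simp add: sparse_class_def)
  also have "\<dots> \<le> v * worst_mse \<epsilon> t"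
    unfolding worst_mse_def using assms \<mu>
    by (intro mult_left_mono cSUP_upper bdd_above_mse_1) auto
  finally show ?thesis .
qed

text \<open>\<open>worst_mse \<epsilon> t < \<delta>\<close> keeps the slope of the linear bound on
  \<open>mse_map\<close> below 1, so the inequality can be solved for \<open>m\<close>.\<close>

lemma fMSE_le:
  assumes "\<nu> \<in> sparse_class \<epsilon>" "0 < \<delta>" "0 \<le> t" "worst_mse \<epsilon> t < \<delta>"
  shows "fMSE t \<delta> 1 \<nu> \<le> ereal (worst_mse \<epsilon> t / (1 - worst_mse \<epsilon> t / \<delta>))"
  unfolding fMSE_def HFP_def
proof (rule SUP_least)
  fix m
  let ?M = "worst_mse \<epsilon> t"
  assume m: "m \<in> {m. 0 \<le> m \<and> m \<le> mse_map m \<delta> 1 t \<nu>}"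
  have "0 < 1 + m / \<delta>"
    using m assms by (simp add: add_pos_nonneg)
  then have "m \<le> (1 + m / \<delta>) * ?M"
    using m mse_le_worst_mse[OF assms(1) _ assms(3), of "1 + m / \<delta>"]
    by (simp add: mse_map_def npi_def)
  then have "m * (1 - ?M / \<delta>) \<le> ?M"
    by (simp add: algebra_simps)
  moreover have "0 < 1 - ?M / \<delta>"
    using assms by simp
  ultimately show "ereal m \<le> ereal (?M / (1 - ?M / \<delta>))"
    by (simp add: pos_le_divide_eq)
qed

(* If w is the scalar risk of some distribution, m = w / (1 - w / \<delta>) solves (1 + m / \<delta>) w = m, so
   rescaling that distribution by the square root of 1 + m / \<delta> makes m a fixed point. *)
lemma fMSE_scaled_ge:
  assumes "\<nu> \<in> sparse_class \<epsilon>" "0 < \<delta>" "0 \<le> w" "w < \<delta>" "w \<le> mse 1 \<nu> t"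
  shows "\<exists>\<mu>\<in>sparse_class \<epsilon>. ereal (w / (1 - w / \<delta>)) \<le> fMSE t \<delta> 1 \<mu>"
proof -
  define m where "m = w / (1 - w / \<delta>)"
  have pos: "0 < 1 - w / \<delta>"
    using assms by simp
  then have m: "0 \<le> m" "m * (1 - w / \<delta>) = w"
    using assms(3) by (auto simp: m_def)
  define v where "v = 1 + m / \<delta>"
  have v: "0 < v" "v * w = m"
    using m assms by (auto simp: v_def algebra_simps add_pos_nonneg)
  define \<mu> where "\<mu> = distr \<nu> borel ((*) (sqrt v))"
  have "m \<le> v * mse 1 \<nu> t"
    using v assms(5) mult_left_mono[of w "mse 1 \<nu> t" v] by simp
  also have "\<dots> = mse_map m \<delta> 1 t \<mu>"
    unfolding \<mu>_def mse_map_def npi_def using mse_scale[of \<nu> v t] v assms(1)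
    by (simp add: sparse_class_def v_def)
  finally have "ereal m \<le> fMSE t \<delta> 1 \<mu>"
    unfolding fMSE_def HFP_def using m(1) by (intro SUP_upper) auto
  moreover have "\<mu> \<in> sparse_class \<epsilon>"
    unfolding \<mu>_def using v assms(1) by (intro scale_sparse_class) auto
  ultimately show ?thesis
    by (auto simp: m_def)
qed

text \<open>\<open>M\<close> is any lower bound of the worst risk that lies below \<delta>. The
  worst risk of a poor threshold may itself reach \<delta>, where the formula no longer makes
  sense.\<close>

lemma SUP_fMSE_ge:
  assumes "0 \<le> \<epsilon>" "\<epsilon> \<le> 1" "0 < \<delta>" "0 \<le> M" "M < \<delta>" "M \<le> worst_mse \<epsilon> t" "0 \<le> t"
  shows "ereal (M / (1 - M / \<delta>)) \<le> (SUP \<nu>\<in>sparse_class \<epsilon>. fMSE t \<delta> 1 \<nu>)" (is "_ \<le> ?S")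
proof (cases "M = 0")
  case True
  obtain \<nu> where "\<nu> \<in> sparse_class \<epsilon>"
    using two_point_sparse[OF assms(1,2)] by auto
  moreover have "0 \<le> mse 1 \<nu> t"
    unfolding mse_def by (auto intro!: Bochner_Integration.integral_nonneg)
  ultimately obtain \<mu> where "\<mu> \<in> sparse_class \<epsilon>" "ereal (M / (1 - M / \<delta>)) \<le> fMSE t \<delta> 1 \<mu>"
    using fMSE_scaled_ge[of \<nu> \<epsilon> \<delta> M t] assms True by auto
  then show ?thesis
    by (auto intro: SUP_upper2)
next
  case False
  \<comment> \<open>The supremum in \<open>worst_mse\<close> need not be attained, so levels
    \<open>w < M\<close> are used and \<open>w\<close> tends to \<open>M\<close> from the left. This
    requires \<open>M > 0\<close>.\<close>
  have "((\<lambda>w. ereal (w / (1 - w / \<delta>))) \<longlongrightarrow> ereal (M / (1 - M / \<delta>))) (at_left M)"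
    using assms by (auto intro!: tendsto_eq_intros)
  moreover have "\<forall>\<^sub>F w in at_left M. ereal (w / (1 - w / \<delta>)) \<le> ?S"
    unfolding eventually_at_left_field
  proof (intro exI[of _ 0] conjI allI impI)
    show "0 < M"
      using False assms by simp
    fix w
    assume w: "0 < w" "w < M"
    then have "w < worst_mse \<epsilon> t"
      using assms by simp
    then obtain \<nu> where "\<nu> \<in> sparse_class \<epsilon>" "w < mse 1 \<nu> t"
      unfolding worst_mse_def using two_point_sparse[OF assms(1,2)] bdd_above_mse_1[OF assms(7)]
      by (subst (asm) less_cSUP_iff) auto
    then obtain \<mu> where "\<mu> \<in> sparse_class \<epsilon>" "ereal (w / (1 - w / \<delta>)) \<le> fMSE t \<delta> 1 \<mu>"
      using fMSE_scaled_ge[of \<nu> \<epsilon> \<delta> w t] assms w by auto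
    then show "ereal (w / (1 - w / \<delta>)) \<le> ?S"
      by (auto intro: SUP_upper2)
  qed
  ultimately show ?thesis
    by (rule tendsto_upperbound) simp
qed

theorem proposition4p1:
  fixes \<delta> \<rho> :: real
  assumes "0 < \<delta>" and "\<delta> < 1"
    and "0 < \<rho>" and "\<rho> < rho_MSE \<delta>"
  shows "minimax_fMSE \<delta> \<rho> =
           ereal (minimax_mse (\<delta> * \<rho>) / (1 - minimax_mse (\<delta> * \<rho>) / \<delta>))
       \<and> (SUP \<nu>\<in>sparse_class (\<delta> * \<rho>). fMSE (threshold_rule \<delta> \<rho>) \<delta> 1 \<nu>) =
           (INF \<tau>\<in>{0<..}. SUP \<nu>\<in>sparse_class (\<delta> * \<rho>). fMSE \<tau> \<delta> 1 \<nu>)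
       \<and> (INF \<tau>\<in>{0<..}. SUP \<nu>\<in>sparse_class (\<delta> * \<rho>). fMSE \<tau> \<delta> 1 \<nu>) = minimax_fMSE \<delta> \<rho>"
proof -
  define \<epsilon> where "\<epsilon> = \<delta> * \<rho>"
  define M where "M = minimax_mse \<epsilon>"
  let ?S = "\<lambda>t. SUP \<nu>\<in>sparse_class \<epsilon>. fMSE t \<delta> 1 \<nu>"
  have r: "rho_MSE \<delta> * \<delta> \<le> 1" "minimax_mse (rho_MSE \<delta> * \<delta>) = \<delta>"
    using rho_MSE_props[OF assms(1,2)] by auto
  have "\<epsilon> < rho_MSE \<delta> * \<delta>"
    using assms by (simp add: \<epsilon>_def mult.commute)
  then have \<epsilon>: "0 < \<epsilon>" "\<epsilon> < 1" "0 \<le> \<epsilon>" "\<epsilon> \<le> 1"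
    using r(1) mult_pos_pos[OF assms(1,3)] unfolding \<epsilon>_def[symmetric] by linarith+
  \<comment> \<open>The weak bound comes first: with \<open>\<delta> < 1\<close> it gives
    \<open>M < 1\<close>, the premise of \<open>minimax_mse_less\<close>.\<close>
  have "M \<le> \<delta>"
    unfolding M_def using minimax_mse_mono[of \<epsilon> "rho_MSE \<delta> * \<delta>"] \<epsilon> r \<open>\<epsilon> < rho_MSE \<delta> * \<delta>\<close> by simp
  then have "M < \<delta>"
    unfolding M_def using minimax_mse_less[of \<epsilon> "rho_MSE \<delta> * \<delta>"] \<epsilon> r \<open>\<epsilon> < rho_MSE \<delta> * \<delta>\<close> assms(2)
    by simp
  define T where "T = minimax_threshold \<epsilon>"
  have T: "0 < T" "worst_mse \<epsilon> T = M"
    using minimax_threshold_props[OF \<epsilon>(1,2)] by (auto simp: T_def M_def)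
  \<comment> \<open>Every threshold is compared with the common level \<open>M\<close> rather than
    with its own worst risk.\<close>
  have lower: "ereal (M / (1 - M / \<delta>)) \<le> ?S t" if "0 < t" for t
  proof (rule SUP_fMSE_ge)
    show "0 \<le> M" "M \<le> worst_mse \<epsilon> t"
      using \<epsilon> that minimax_mse_nonneg minimax_mse_le by (auto simp: M_def worst_mse_eq)
  qed (use \<epsilon> assms \<open>M < \<delta>\<close> that in auto)
  \<comment> \<open>At \<open>T\<close> the worst risk equals \<open>M\<close>, so the upper bound
    meets the lower one.\<close>
  have "?S T \<le> ereal (M / (1 - M / \<delta>))"
    using fMSE_le[of _ \<epsilon> \<delta> T] T assms(1) \<open>M < \<delta>\<close> by (intro SUP_least) auto
  then have S: "?S T = ereal (M / (1 - M / \<delta>))"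
    using lower[OF T(1)] by (rule antisym)
  have "(INF t\<in>{0<..}. ?S t) = ereal (M / (1 - M / \<delta>))"
  proof (rule antisym)
    show "(INF t\<in>{0<..}. ?S t) \<le> ereal (M / (1 - M / \<delta>))"
      using T(1) S by (intro INF_lower2[of T]) auto
    show "ereal (M / (1 - M / \<delta>)) \<le> (INF t\<in>{0<..}. ?S t)"
      by (rule INF_greatest) (use lower in simp)
  qed
  then show ?thesis
    using S unfolding minimax_fMSE_def threshold_rule_def
    by (simp only: \<epsilon>_def[symmetric] T_def[symmetric] M_def[symmetric])
qed

end
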